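(* Let $f:\mathbb R^d\to\mathbb R$ be differentiable and let $\mathbf L=(L_1,\dots,L_d)$ be a nonnegative vector such that for all $\mathbf x,\mathbf y\in\mathbb R^d$, $f(\mathbf y)\le f(\mathbf x)+\langle\nabla f(\mathbf x),\mathbf y-\mathbf x\rangle+\frac12\sum_{i=1}^dL_i(y_i-x_i)^2$. Let $\mathcal Q$ be the finite codebook described in the context, with scale-sharing groups $G$ and $s_i=s_G$ for $i\in G$; let $f^*_{\mathcal Q}=\min_{\mathbf q\in\mathcal Q}f(\mathbf q)$ and $L_G=\max_{i\in G}L_i$. Let $\gamma\ge0$, $\eta>0$, $T\ge1$, and let $(\mathbf q_t)_{t\ge0}$ be generated by QAR-$\gamma$ (see context) from $\mathbf q_0\in\mathcal Q$ with stepsize $\eta$ and routes $\mathbf u_t$ satisfying $\|\mathbf u_t\|_\infty\le U<\infty$. Let $b_{t,i}$ be the power score of coordinate $i$ at step $t$, and assume almost surely that $\eta Ub_{t,i}\le s_G$ for every $t<T$, every group $G$ and every $i\in G$. (GD) If $\mathbf u_t=\nabla f(\mathbf q_t)$ for all $t$, then $$\frac1T\sum_{t=0}^{T-1}\mathbb E\big[\|\mathbf g_{\mathcal Q}(\mathbf q_t)\|_2^2\big]\le\frac1T\sum_{t=0}^{T-1}\mathbb E\Big[\sum_G\sum_{i\in G}b_{t,i}\big(\mathbf g_{\mathcal Q}(\mathbf q_t)\big)_i^2\Big]\le\frac{2(f(\mathbf q_0)-f^*_{\mathcal Q})}{\eta T}+\frac14\sum_G|G|L_G^2s_G^2.$$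 (signGD) If $\mathbf u_t=\operatorname{sign}(\nabla f(\mathbf q_t))$ for all $t$, then $$\frac1T\sum_{t=0}^{T-1}\mathbb E\big[\|\mathbf g_{\mathcal Q}(\mathbf q_t)\|_1\big]\le\frac{f(\mathbf q_0)-f^*_{\mathcal Q}}{\eta T}+\frac12\sum_G|G|L_Gs_G.$$
   Context: Codebook: for each $i\in\{1,\dots,d\}$ let $\mathcal K_i=\{\underline k_i,\underline k_i+1,\dots,\overline k_i\}\subset\mathbb Z$ with $\underline k_i\le\overline k_i$, let $s_i>0$, and $\mathcal Q=\{\mathbf q:\ q_i=s_ik_i,\ k_i\in\mathcal K_i\ \forall i\}$. The coordinates are partitioned into scale-sharing groups $G$, with $s_i=s_G$ for all $i\in G$. Convention $\operatorname{sign}(0)=0$, and $\operatorname{sign}$ acts coordinatewise. Feasible endpoint gradient: for $\mathbf q\in\mathcal Q$ with $q_i=s_ik_i$ and $\mathbf g=\nabla f(\mathbf q)$, $(\mathbf g_{\mathcal Q}(\mathbf q))_i=g_i\,\mathbf 1\{k_i-\operatorname{sign}(g_i)\in\mathcal K_i\}$. QAR-$\gamma$: at step $t$ with code $\mathbf k_t$ ($\mathbf q_t=\mathbf s\odot\mathbf k_t\in\mathcal Q$) and route $\mathbf u_t\in\mathbb R^d$, set $z_{t,i}=\operatorname{sign}(u_{t,i})$, feasibility mask $M_{t,i}=\mathbf 1\{k_{t,i}-z_{t,i}\in\mathcal K_i\}$, and $a_{t,i}=M_{t,i}|u_{t,i}|$. The power score for $i\in G$ is $b_{t,i}=a_{t,i}^\gamma\big/\big(|G|^{-1}\sum_{j\in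 G}a_{t,j}^\gamma\big)$ if $\gamma>0$ and $\sum_{j\in G}a_{t,j}^\gamma>0$, and $b_{t,i}=1$ otherwise. Set $p_{t,i}=\min\{\eta a_{t,i}b_{t,i}/s_G,\,1\}$ for $i\in G$; conditionally on the past, sample $J_{t,i}\sim\mathrm{Bernoulli}(p_{t,i})$ coordinatewise with fresh randomness; and set $k_{t+1,i}=k_{t,i}-z_{t,i}J_{t,i}$, $\mathbf q_{t+1}=\mathbf s\odot\mathbf k_{t+1}$. *)

theory Defs
  imports "HOL-Probability.Probability"
begin

text \<open>
  Integer codes are vectors \<open>k :: int^'n\<close>; the admissible range of coordinate \<open>i\<close> is
  \<open>{klo $ i..khi $ i}\<close>. The quantized point of a code is the coordinatewise product with
  the scale vector, and the codebook is the image of the set of admissible codes. Since all scales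
  are positive, a point of the codebook determines its code; notions that depend on a codebook
  point through its code therefore take the code as argument.
\<close>

definition admissible_codes :: "int^'n \<Rightarrow> int^'n \<Rightarrow> (int^'n) set" where
  "admissible_codes klo khi = {k. \<forall>i. k $ i \<in> {klo $ i..khi $ i}}"

definition code_point :: "real^'n \<Rightarrow> int^'n \<Rightarrow> real^'n" where
  "code_point s k = (\<chi> i. s $ i * of_int (k $ i))"

definition codebook :: "real^'n \<Rightarrow> int^'n \<Rightarrow> int^'n \<Rightarrow> (real^'n) set" where
  "codebook s klo khi = code_point s ` admissible_codes klo khi"

lemma finite_codebook:
  fixes s :: "real^'n"
  shows "finite (codebook s klo khi)"
proof -
  have "admissible_codes klo khi \<subseteq> vec_lambda ` (\<Pi>\<^sub>E i\<in>(UNIV :: 'n set). {klo $ i..khi $ i})"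
  proof
    fix k assume k: "k \<in> admissible_codes klo khi"
    have "vec_nth k \<in> (\<Pi>\<^sub>E i\<in>(UNIV :: 'n set). {klo $ i..khi $ i})"
      using k by (auto simp: admissible_codes_def)
    then have "vec_lambda (vec_nth k) \<in> vec_lambda ` (\<Pi>\<^sub>E i\<in>(UNIV :: 'n set). {klo $ i..khi $ i})"
      by (rule imageI)
    then show "k \<in> vec_lambda ` (\<Pi>\<^sub>E i\<in>(UNIV :: 'n set). {klo $ i..khi $ i})"
      by simp
  qed
  then have "finite (admissible_codes klo khi)"
    by (rule finite_subset) (intro finite_imageI finite_PiE; simp)
  then show ?thesis
    by (simp add: codebook_def)
qed

text \<open>
  The library's \<open>sgn\<close> on \<open>real^'n\<close> is normalization to unit length, not the
  coordinatewise sign, so the latter is defined separately.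
\<close>

definition sign_vec :: "real^'n \<Rightarrow> real^'n" where
  "sign_vec v = (\<chi> i. sgn (v $ i))"

definition sign_int :: "real \<Rightarrow> int" where
  "sign_int x = (if x > 0 then 1 else if x < 0 then - 1 else 0)"

lemma of_int_sign_int: "of_int (sign_int x) = sgn x"
  by (simp add: sign_int_def sgn_if)

definition feasible_part :: "int^'n \<Rightarrow> int^'n \<Rightarrow> int^'n \<Rightarrow> real^'n \<Rightarrow> real^'n" where
  "feasible_part klo khi k g =
    (\<chi> i. g $ i * of_bool (k $ i - sign_int (g $ i) \<in> {klo $ i..khi $ i}))"

definition masked_magnitude :: "int^'n \<Rightarrow> int^'n \<Rightarrow> int^'n \<Rightarrow> real^'n \<Rightarrow> real^'n" where
  "masked_magnitude klo khi k u =
    (\<chi> i. of_bool (k $ i - sign_int (u $ i) \<in> {klo $ i..khi $ i}) * \<bar>u $ i\<bar>)"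

definition power_score :: "real \<Rightarrow> 'n set \<Rightarrow> real^'n \<Rightarrow> 'n \<Rightarrow> real" where
  "power_score \<gamma> G a i =
    (if \<gamma> > 0 \<and> (\<Sum>j\<in>G. (a $ j) powr \<gamma>) > 0
     then (a $ i) powr \<gamma> / ((\<Sum>j\<in>G. (a $ j) powr \<gamma>) / real (card G))
     else 1)"

definition move_prob :: "real \<Rightarrow> real \<Rightarrow> ('n set \<Rightarrow> real) \<Rightarrow> 'n set \<Rightarrow> real^'n \<Rightarrow> 'n \<Rightarrow> real" where
  "move_prob \<gamma> \<eta> \<sigma> G a i = min (\<eta> * a $ i * power_score \<gamma> G a i / \<sigma> G) 1"

text \<open>
  \<open>F t\<close> is the past at step \<open>t\<close>: it contains the code and the route of step \<open>t\<close>, but the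
  bits \<open>J t\<close> are only known at step \<open>t + 1\<close>. The last clause says that, conditionally on
  \<open>F t\<close>, the coordinates of \<open>J t\<close> are independent Bernoulli variables: the conditional
  probability of every bit pattern is the product of the Bernoulli weights, taken group by group.
\<close>

definition qar_process ::
  "'a measure \<Rightarrow> (nat \<Rightarrow> 'a measure) \<Rightarrow> 'n::finite set set \<Rightarrow> ('n set \<Rightarrow> real) \<Rightarrow>
   int^'n \<Rightarrow> int^'n \<Rightarrow> real \<Rightarrow> real \<Rightarrow> int^'n \<Rightarrow>
   (nat \<Rightarrow> 'a \<Rightarrow> real^'n) \<Rightarrow> (nat \<Rightarrow> 'a \<Rightarrow> bool^'n) \<Rightarrow> (nat \<Rightarrow> 'a \<Rightarrow> int^'n) \<Rightarrow> bool" where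
  "qar_process M F \<G> \<sigma> klo khi \<gamma> \<eta> k0 u J k \<longleftrightarrow>
     filtration (space M) F \<and>
     (\<forall>t. subalgebra M (F t)) \<and>
     (\<forall>t. k t \<in> measurable (F t) (count_space UNIV)) \<and>
     (\<forall>t. u t \<in> borel_measurable (F t)) \<and>
     (\<forall>t. J t \<in> measurable (F (Suc t)) (count_space UNIV)) \<and>
     (\<forall>\<omega>\<in>space M. k 0 \<omega> = k0) \<and>
     (\<forall>t. \<forall>\<omega>\<in>space M. \<forall>i.
        k (Suc t) \<omega> $ i = k t \<omega> $ i - sign_int (u t \<omega> $ i) * of_bool (J t \<omega> $ i)) \<and>
     (\<forall>t j. AE \<omega> in M.
        real_cond_exp M (F t) (indicator {\<omega>' \<in> space M. J t \<omega>' = j}) \<omega> =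
        (\<Prod>G\<in>\<G>. \<Prod>i\<in>G.
           pmf (bernoulli_pmf
                 (move_prob \<gamma> \<eta> \<sigma> G (masked_magnitude klo khi (k t \<omega>) (u t \<omega>)) i)) (j $ i)))"

end

theory Submission
  imports Defs
begin

text \<open>
  Without clipping, coordinate \<open>i\<close> moves by \<open>s\<^sub>i\<close> against its route with conditional probability
  \<open>\<eta> a\<^sub>i b\<^sub>i / s\<^sub>i\<close>, so the expected decrease of \<open>f\<close> in one step is at least
  \<open>\<eta> \<Sum>\<^sub>i b\<^sub>i (a\<^sub>i \<bar>g\<^sub>i\<bar> - L\<^sub>i s\<^sub>i a\<^sub>i / 2)\<close>. For gradient routes
  \<open>L\<^sub>i s\<^sub>i a\<^sub>i / 2 \<le> a\<^sub>i\<^sup>2 / 2 + L\<^sub>i\<^sup>2 s\<^sub>i\<^sup>2 / 8\<close>; for sign routes \<open>a\<^sub>i\<close> is \<open>0\<close> or \<open>1\<close>, and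
  \<open>b\<^sub>i \<ge> 1\<close> where it is \<open>1\<close>. Power scores average to \<open>1\<close> over each group, which gives the error
  terms, and telescoping gives both rates. Inserting the power scores only increases the sum of
  squares, by Chebyshev's sum inequality.
\<close>

section \<open>Sums over a partition and over bit vectors\<close>

text \<open>Makes the group a function of the coordinate, so that data attached to groups can be
  indexed by coordinates. The description denotes something meaningful only for points covered by a
  partition.\<close>

definition cell :: "'a set set \<Rightarrow> 'a \<Rightarrow> 'a set" where
  "cell P x = (THE A. A \<in> P \<and> x \<in> A)"

lemma cell_eq:
  assumes "partition_on S P" "A \<in> P" "x \<in> A"
  shows "cell P x = A"
  unfolding cell_def
proof (rule the_equality)
  show "A \<in> P \<and> x \<in> A" using assms by simp
next
  fix B assume "B \<in> P \<and> x \<in> B"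
  then show "B = A" using assms by (auto simp: partition_on_def disjoint_def)
qed

lemma cell_mem:
  assumes "partition_on S P" "x \<in> S"
  shows "cell P x \<in> P" "x \<in> cell P x"
proof -
  obtain A where "A \<in> P" "x \<in> A" using assms by (auto simp: partition_on_def)
  with cell_eq[OF assms(1)] show "cell P x \<in> P" "x \<in> cell P x" by simp_all
qed

text \<open>Stated for an arbitrary commutative monoid because it is needed twice: for sums of
  scores over groups and for the group-by-group product of Bernoulli weights.\<close>

lemma (in comm_monoid_set) partition_on_cell:
  assumes "partition_on S P" "finite S"
  shows "F (\<lambda>A. F (\<lambda>x. h A x) A) P = F (\<lambda>x. h (cell P x) x) S"
proof -
  have S: "S = \<Union>P" using assms(1) by (simp add: partition_on_def)
  have fin: "\<forall>A\<in>P. finite A" using assms S by (metis Union_upper finite_subset)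
  have disj: "\<forall>A\<in>P. \<forall>B\<in>P. A \<noteq> B \<longrightarrow> A \<inter> B = {}"
    using assms(1) by (auto simp: partition_on_def disjoint_def)
  have "F (\<lambda>x. h (cell P x) x) S = F (\<lambda>A. F (\<lambda>x. h (cell P x) x) A) P"
    unfolding S using Union_disjoint[OF fin disj] by simp
  also have "\<dots> = F (\<lambda>A. F (\<lambda>x. h A x) A) P"
    by (intro cong refl) (simp add: cell_eq[OF assms(1)])
  finally show ?thesis by simp
qed

text \<open>Distributivity: expanding the product on the right picks one bit per coordinate, that
  is, one bit vector per summand.\<close>

lemma sum_prod_bool_vec:
  fixes h :: "'n::finite \<Rightarrow> bool \<Rightarrow> 'a::comm_semiring_1"
  shows "(\<Sum>j\<in>(UNIV :: (bool^'n) set). \<Prod>i\<in>UNIV. h i (j $ i)) = (\<Prod>i\<in>UNIV. h i True + h i False)"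
proof -
  have "(\<Prod>i\<in>UNIV. h i True + h i False) = (\<Prod>i\<in>UNIV. \<Sum>x\<in>UNIV. h i x)"
    by (simp add: UNIV_bool add.commute)
  also have "\<dots> = (\<Sum>g\<in>(\<Pi>\<^sub>E i\<in>UNIV. UNIV). \<Prod>i\<in>UNIV. h i (g i))"
    by (rule prod_sum_PiE) simp_all
  also have "\<dots> = (\<Sum>j\<in>(UNIV :: (bool^'n) set). \<Prod>i\<in>UNIV. h i (j $ i))"
    by (rule sum.reindex_bij_witness[where i = vec_nth and j = vec_lambda])
       (auto simp: vec_lambda_inverse vec_nth_inverse)
  finally show ?thesis by simp
qed

lemma sum_bernoulli_weights:
  fixes p :: "'n::finite \<Rightarrow> real"
  assumes "\<And>i. 0 \<le> p i" "\<And>i. p i \<le> 1"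
  shows "(\<Sum>j\<in>(UNIV :: (bool^'n) set). \<Prod>i\<in>UNIV. pmf (bernoulli_pmf (p i)) (j $ i)) = 1"
  by (subst sum_prod_bool_vec) (simp add: assms)

text \<open>The factor \<open>of_bool (j $ l)\<close> is absorbed into the factor at
  \<open>l\<close>, where it removes the \<open>False\<close> term and leaves \<open>p l\<close>;
  every other coordinate contributes total mass 1.\<close>

lemma sum_bernoulli_weights_marginal:
  fixes p :: "'n::finite \<Rightarrow> real"
  assumes "\<And>i. 0 \<le> p i" "\<And>i. p i \<le> 1"
  shows "(\<Sum>j\<in>(UNIV :: (bool^'n) set). (\<Prod>i\<in>UNIV. pmf (bernoulli_pmf (p i)) (j $ i)) * of_bool (j $ l)) = p l"
proof -
  define h where "h i x = pmf (bernoulli_pmf (p i)) x * (if i = l then of_bool x else 1)" for i x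
  have "(\<Sum>j\<in>(UNIV :: (bool^'n) set). (\<Prod>i\<in>UNIV. pmf (bernoulli_pmf (p i)) (j $ i)) * of_bool (j $ l))
      = (\<Sum>j\<in>(UNIV :: (bool^'n) set). \<Prod>i\<in>UNIV. h i (j $ i))"
    by (simp add: h_def prod.distrib)
  also have "\<dots> = (\<Prod>i\<in>UNIV. h i True + h i False)" by (rule sum_prod_bool_vec)
  also have "\<dots> = (\<Prod>i\<in>UNIV. if i = l then p l else 1)"
    by (rule prod.cong) (simp_all add: h_def assms)
  also have "\<dots> = p l" by simp
  finally show ?thesis .
qed

section \<open>Power scores\<close>

lemma power_score_nonneg: "0 \<le> power_score \<gamma> G a i"
  by (simp add: power_score_def sum_nonneg)

text \<open>In the main case the scores are powers divided by their mean; in the default case each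
  score is 1. Both give average 1.\<close>

lemma sum_power_score:
  assumes "finite G"
  shows "(\<Sum>i\<in>G. power_score \<gamma> G a i) = real (card G)"
proof (cases "\<gamma> > 0 \<and> (\<Sum>j\<in>G. (a $ j) powr \<gamma>) > 0")
  case True
  then have "(\<Sum>i\<in>G. power_score \<gamma> G a i)
      = (\<Sum>i\<in>G. (a $ i) powr \<gamma>) / ((\<Sum>j\<in>G. (a $ j) powr \<gamma>) / real (card G))"
    by (simp add: power_score_def sum_divide_distrib)
  with True show ?thesis by simp
next
  case False
  then have "power_score \<gamma> G a i = 1" for i unfolding power_score_def by (rule if_not_P)
  then show ?thesis by simp
qed

text \<open>A maximal magnitude has a power at least as large as the mean power. For sign routes
  this applies to every coordinate with nonzero masked magnitude.\<close>

lemma power_score_ge_one: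
  assumes "finite G" "i \<in> G" "\<And>j. j \<in> G \<Longrightarrow> 0 \<le> a $ j" "\<And>j. j \<in> G \<Longrightarrow> a $ j \<le> a $ i"
  shows "1 \<le> power_score \<gamma> G a i"
proof (cases "\<gamma> > 0 \<and> (\<Sum>j\<in>G. (a $ j) powr \<gamma>) > 0")
  case True
  have "(\<Sum>j\<in>G. (a $ j) powr \<gamma>) \<le> (\<Sum>j\<in>G. (a $ i) powr \<gamma>)"
    using True assms by (intro sum_mono powr_mono2) auto
  moreover have "real (card G) > 0" using assms by (auto simp: card_gt_0_iff)
  ultimately show ?thesis using True by (simp add: power_score_def field_simps)
next
  case False
  then have "power_score \<gamma> G a i = 1" unfolding power_score_def by (rule if_not_P)
  then show ?thesis by simp
qed

text \<open>Summing the nonnegative products over all pairs and expanding yields exactly twice the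
  difference of the two sides.\<close>

lemma Chebyshev_sum_similarly_ordered:
  fixes x y :: "'a \<Rightarrow> 'b::linordered_idom"
  assumes "\<And>i j. i \<in> A \<Longrightarrow> j \<in> A \<Longrightarrow> 0 \<le> (x i - x j) * (y i - y j)"
  shows "(\<Sum>i\<in>A. x i) * (\<Sum>i\<in>A. y i) \<le> of_nat (card A) * (\<Sum>i\<in>A. x i * y i)"
proof -
  have "0 \<le> (\<Sum>i\<in>A. \<Sum>j\<in>A. (x i - x j) * (y i - y j))"
    using assms by (intro sum_nonneg)
  also have "\<dots> = (\<Sum>i\<in>A. \<Sum>j\<in>A. x i * y i) + (\<Sum>i\<in>A. \<Sum>j\<in>A. x j * y j)
      - (\<Sum>i\<in>A. \<Sum>j\<in>A. x i * y j) - (\<Sum>i\<in>A. \<Sum>j\<in>A. x j * y i)"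
    by (simp add: algebra_simps sum.distrib sum_subtractf)
  also have "(\<Sum>i\<in>A. \<Sum>j\<in>A. x i * y i) = of_nat (card A) * (\<Sum>i\<in>A. x i * y i)"
    by (simp add: sum_distrib_left)
  also have "(\<Sum>i\<in>A. \<Sum>j\<in>A. x j * y j) = of_nat (card A) * (\<Sum>i\<in>A. x i * y i)"
    by simp
  also have "(\<Sum>i\<in>A. \<Sum>j\<in>A. x i * y j) = (\<Sum>i\<in>A. x i) * (\<Sum>i\<in>A. y i)"
    by (simp add: sum_product)
  also have "(\<Sum>i\<in>A. \<Sum>j\<in>A. x j * y i) = (\<Sum>i\<in>A. x i) * (\<Sum>i\<in>A. y i)"
    by (subst sum.swap) (simp add: sum_product)
  finally have "0 \<le> 2 * (of_nat (card A) * (\<Sum>i\<in>A. x i * y i) - (\<Sum>i\<in>A. x i) * (\<Sum>i\<in>A. y i))"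
    by (simp add: algebra_simps)
  then show ?thesis by (simp add: zero_le_mult_iff)
qed

text \<open>On nonnegative magnitudes the \<open>\<gamma>\<close>-th powers and the squares are
  ordered alike, so Chebyshev's inequality applies; dividing by the sum of powers produces the
  scores.\<close>

lemma sum_power_score_square_ge:
  assumes "finite G" "\<And>i. i \<in> G \<Longrightarrow> 0 \<le> a $ i"
  shows "(\<Sum>i\<in>G. (a $ i)\<^sup>2) \<le> (\<Sum>i\<in>G. power_score \<gamma> G a i * (a $ i)\<^sup>2)"
proof (cases "\<gamma> > 0 \<and> (\<Sum>j\<in>G. (a $ j) powr \<gamma>) > 0")
  case True
  define S where "S = (\<Sum>j\<in>G. (a $ j) powr \<gamma>)"
  have S: "S > 0" and \<gamma>: "\<gamma> > 0" using True by (simp_all add: S_def)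
  have "S * (\<Sum>i\<in>G. (a $ i)\<^sup>2) \<le> real (card G) * (\<Sum>i\<in>G. (a $ i) powr \<gamma> * (a $ i)\<^sup>2)"
    unfolding S_def
  proof (rule Chebyshev_sum_similarly_ordered)
    fix i j assume ij: "i \<in> G" "j \<in> G"
    show "0 \<le> ((a $ i) powr \<gamma> - (a $ j) powr \<gamma>) * ((a $ i)\<^sup>2 - (a $ j)\<^sup>2)"
    proof (cases "a $ i \<le> a $ j")
      case True
      then have "(a $ i) powr \<gamma> \<le> (a $ j) powr \<gamma>" "(a $ i)\<^sup>2 \<le> (a $ j)\<^sup>2"
        using assms(2) ij \<gamma> by (auto intro!: powr_mono2 power_mono)
      then show ?thesis by (simp add: mult_nonpos_nonpos)
    next
      case False
      then have "(a $ j) powr \<gamma> \<le> (a $ i) powr \<gamma>" "(a $ j)\<^sup>2 \<le> (a $ i)\<^sup>2"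
        using assms(2) ij \<gamma> by (auto intro!: powr_mono2 power_mono)
      then show ?thesis by simp
    qed
  qed
  moreover have "(\<Sum>i\<in>G. power_score \<gamma> G a i * (a $ i)\<^sup>2)
      = real (card G) * (\<Sum>i\<in>G. (a $ i) powr \<gamma> * (a $ i)\<^sup>2) / S"
    using True unfolding power_score_def S_def[symmetric]
    by (simp add: sum_distrib_left sum_divide_distrib mult_ac)
  ultimately show ?thesis using S by (simp add: pos_le_divide_eq mult.commute)
next
  case False
  then have "power_score \<gamma> G a i = 1" for i unfolding power_score_def by (rule if_not_P)
  then show ?thesis by simp
qed

section \<open>One random move\<close>

lemma masked_magnitude_nonneg: "0 \<le> masked_magnitude klo khi k u $ i"
  by (simp add: masked_magnitude_def)

lemma masked_magnitude_le: "masked_magnitude klo khi k u $ i \<le> infnorm u"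
  using component_le_infnorm_cart[of u i] infnorm_pos_le[of u] by (simp add: masked_magnitude_def)

lemma abs_feasible_part: "\<bar>feasible_part klo khi k g $ i\<bar> = masked_magnitude klo khi k g $ i"
  by (simp add: feasible_part_def masked_magnitude_def abs_mult)

text \<open>The feasibility mask is absent here on purpose: it acts through the probabilities, which
  vanish at infeasible coordinates.\<close>

definition move :: "int^'n \<Rightarrow> real^'n \<Rightarrow> bool^'n \<Rightarrow> int^'n" where
  "move k u j = (\<chi> i. k $ i - sign_int (u $ i) * of_bool (j $ i))"

text \<open>The quadratic bound is diagonal and a bit equals its own square, so the upper bound for
  \<open>f\<close> after the move is affine in the bits. Its expectation therefore involves only the
  marginals \<open>p i\<close>.\<close>

lemma expected_descent:
  fixes f :: "real^'n \<Rightarrow> real" and p :: "'n \<Rightarrow> real"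
  assumes smooth: "\<And>x y. f y \<le> f x + gradf x \<bullet> (y - x) + 1/2 * (\<Sum>i\<in>UNIV. L $ i * (y $ i - x $ i)\<^sup>2)"
    and p: "\<And>i. 0 \<le> p i" "\<And>i. p i \<le> 1"
  shows "(\<Sum>j\<in>UNIV. (\<Prod>i\<in>UNIV. pmf (bernoulli_pmf (p i)) (j $ i)) * f (code_point s (move k u j)))
    \<le> f (code_point s k) - (\<Sum>i\<in>UNIV. p i *
        (s $ i * (gradf (code_point s k) $ i * sgn (u $ i)) - 1/2 * (L $ i * (s $ i * sgn (u $ i))\<^sup>2)))"
proof -
  define w where "w j = (\<Prod>i\<in>UNIV. pmf (bernoulli_pmf (p i)) (j $ i))" for j :: "bool^'n"
  define x where "x = code_point s k"
  \<comment> \<open>\<open>c i\<close> is the decrease that the smoothness bound guarantees for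
    moving coordinate \<open>i\<close>.\<close>
  define c where "c i = s $ i * (gradf x $ i * sgn (u $ i)) - 1/2 * (L $ i * (s $ i * sgn (u $ i))\<^sup>2)" for i
  have diff: "code_point s (move k u j) $ i - x $ i = - (s $ i * sgn (u $ i) * of_bool (j $ i))" for i j
    by (simp add: code_point_def move_def x_def of_int_sign_int algebra_simps)
  have "f (code_point s (move k u j)) \<le> f x - (\<Sum>i\<in>UNIV. c i * of_bool (j $ i))" for j
  proof -
    have "gradf x \<bullet> (code_point s (move k u j) - x)
        + 1/2 * (\<Sum>i\<in>UNIV. L $ i * (code_point s (move k u j) $ i - x $ i)\<^sup>2)
      = - (\<Sum>i\<in>UNIV. c i * of_bool (j $ i))"
      unfolding inner_vec_def sum_distrib_left sum.distrib[symmetric] sum_negf[symmetric]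
      by (rule sum.cong) (auto simp: diff c_def of_bool_def algebra_simps)
    then show ?thesis using smooth[of "code_point s (move k u j)" x] by linarith
  qed
  then have "(\<Sum>j\<in>UNIV. w j * f (code_point s (move k u j)))
      \<le> (\<Sum>j\<in>UNIV. w j * (f x - (\<Sum>i\<in>UNIV. c i * of_bool (j $ i))))"
    by (intro sum_mono mult_left_mono) (simp_all add: w_def prod_nonneg)
  also have "\<dots> = (\<Sum>j\<in>UNIV. w j) * f x - (\<Sum>i\<in>UNIV. c i * (\<Sum>j\<in>UNIV. w j * of_bool (j $ i)))"
  proof -
    have "w j * (f x - (\<Sum>i\<in>UNIV. c i * of_bool (j $ i)))
        = w j * f x - (\<Sum>i\<in>UNIV. c i * (w j * of_bool (j $ i)))" for j
      by (simp only: right_diff_distrib sum_distrib_left mult.left_commute)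
    moreover have "(\<Sum>j\<in>UNIV. \<Sum>i\<in>UNIV. c i * (w j * of_bool (j $ i)))
        = (\<Sum>i\<in>UNIV. c i * (\<Sum>j\<in>UNIV. w j * of_bool (j $ i)))"
      by (subst sum.swap) (simp only: sum_distrib_left)
    ultimately show ?thesis by (simp only: sum_subtractf sum_distrib_right)
  qed
  also have "\<dots> = f x - (\<Sum>i\<in>UNIV. p i * c i)"
    by (simp only: w_def sum_bernoulli_weights[OF p] sum_bernoulli_weights_marginal[OF p]
        mult_1_left mult.commute[of "c _"])
  finally show ?thesis by (simp add: w_def x_def c_def)
qed

section \<open>Expectations along the process\<close>

lemma level_set_measurable:
  assumes "X \<in> measurable N (count_space UNIV)"
  shows "{\<omega>\<in>space N. X \<omega> = x} \<in> sets N"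
proof -
  have "{\<omega>\<in>space N. X \<omega> = x} = X -` {x} \<inter> space N" by auto
  then show ?thesis using measurable_sets[OF assms, of "{x}"] by simp
qed

text \<open>Almost surely \<open>\<phi> (X \<omega>)\<close> equals a finite combination of
  indicators of level sets. Membership in \<open>A\<close> is only almost sure because the process
  may leave the finite set on a null event.\<close>

lemma (in prob_space) expectation_finite_range:
  fixes \<phi> :: "'b \<Rightarrow> real"
  assumes X: "X \<in> measurable M (count_space UNIV)" and A: "finite A" and AE: "AE \<omega> in M. X \<omega> \<in> A"
  shows "integrable M (\<lambda>\<omega>. \<phi> (X \<omega>))"
    and "expectation (\<lambda>\<omega>. \<phi> (X \<omega>)) = (\<Sum>x\<in>A. \<phi> x * prob {\<omega>\<in>space M. X \<omega> = x})"
proof -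
  let ?E = "\<lambda>x. {\<omega>\<in>space M. X \<omega> = x}"
  have E: "?E x \<in> events" for x
    by (rule level_set_measurable[OF X])
  have int: "integrable M (\<lambda>\<omega>. \<Sum>x\<in>A. \<phi> x * indicator (?E x) \<omega>)"
    by (intro Bochner_Integration.integrable_sum integrable_mult_right integrable_real_indicator E)
       (simp add: emeasure_eq_measure)
  have meas: "(\<lambda>\<omega>. \<phi> (X \<omega>)) \<in> borel_measurable M"
    by (rule measurable_compose[OF X]) simp
  have eq: "AE \<omega> in M. (\<Sum>x\<in>A. \<phi> x * indicator (?E x) \<omega>) = \<phi> (X \<omega>)"
    using AE
  proof (rule AE_mp, intro AE_I2 impI)
    fix \<omega> assume "\<omega> \<in> space M" "X \<omega> \<in> A"
    then have "(\<Sum>x\<in>A. \<phi> x * indicator (?E x) \<omega>) = (\<Sum>x\<in>A. if x = X \<omega> then \<phi> x else 0)"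
      by (intro sum.cong) (auto simp: indicator_def)
    then show "(\<Sum>x\<in>A. \<phi> x * indicator (?E x) \<omega>) = \<phi> (X \<omega>)"
      using \<open>X \<omega> \<in> A\<close> A by simp
  qed
  show "integrable M (\<lambda>\<omega>. \<phi> (X \<omega>))"
    by (rule integrable_cong_AE_imp[OF int meas]) (use eq in \<open>auto\<close>)
  have "expectation (\<lambda>\<omega>. \<phi> (X \<omega>)) = expectation (\<lambda>\<omega>. \<Sum>x\<in>A. \<phi> x * indicator (?E x) \<omega>)"
    by (rule integral_cong_AE) (use meas int eq in auto)
  also have "\<dots> = (\<Sum>x\<in>A. \<phi> x * prob (?E x))"
    using E by (subst Bochner_Integration.integral_sum) (auto simp: emeasure_eq_measure)
  finally show "expectation (\<lambda>\<omega>. \<phi> (X \<omega>)) = (\<Sum>x\<in>A. \<phi> x * prob (?E x))" .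
qed

lemma finite_admissible_codes: "finite (admissible_codes klo (khi :: int^'n))"
proof -
  have "admissible_codes klo khi = vec_lambda ` (\<Pi>\<^sub>E i\<in>(UNIV :: 'n set). {klo $ i..khi $ i})"
    by (auto simp: admissible_codes_def image_iff PiE_iff intro!: bexI[where x = "vec_nth _"])
  then show ?thesis by (simp add: finite_PiE)
qed

text \<open>
  Both routes of the theorem are functions of the current code, which makes the code a Markov
  chain on a finite set.
\<close>

locale code_driven_process = prob_space M for M :: "'a measure" +
  fixes F :: "nat \<Rightarrow> 'a measure" and \<G> :: "'n::finite set set" and \<sigma> :: "'n set \<Rightarrow> real"
    and klo khi k0 :: "int^'n" and \<gamma> \<eta> :: real
    and u :: "nat \<Rightarrow> 'a \<Rightarrow> real^'n" and J :: "nat \<Rightarrow> 'a \<Rightarrow> bool^'n" and k :: "nat \<Rightarrow> 'a \<Rightarrow> int^'n"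
    and v :: "int^'n \<Rightarrow> real^'n"
  assumes process: "qar_process M F \<G> \<sigma> klo khi \<gamma> \<eta> k0 u J k"
    and groups: "partition_on UNIV \<G>"
    and sigma_pos: "\<And>G. G \<in> \<G> \<Longrightarrow> 0 < \<sigma> G"
    and eta_pos: "0 < \<eta>"
    and start: "k0 \<in> admissible_codes klo khi"
    and route: "\<And>t \<omega>. \<omega> \<in> space M \<Longrightarrow> u t \<omega> = v (k t \<omega>)"
begin

text \<open>With the route given by \<open>v\<close>, magnitudes, scores and probabilities become
  functions of the code alone; \<open>cell\<close> supplies the group.\<close>

definition mag :: "int^'n \<Rightarrow> 'n \<Rightarrow> real" where
  "mag \<kappa> i = masked_magnitude klo khi \<kappa> (v \<kappa>) $ i"

definition score :: "int^'n \<Rightarrow> 'n \<Rightarrow> real" where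
  "score \<kappa> i = power_score \<gamma> (cell \<G> i) (masked_magnitude klo khi \<kappa> (v \<kappa>)) i"

definition prb :: "int^'n \<Rightarrow> 'n \<Rightarrow> real" where
  "prb \<kappa> i = move_prob \<gamma> \<eta> \<sigma> (cell \<G> i) (masked_magnitude klo khi \<kappa> (v \<kappa>)) i"

text \<open>The transition kernel of the chain, indexed by bit patterns, as a single product over
  all coordinates.\<close>

definition weight :: "int^'n \<Rightarrow> bool^'n \<Rightarrow> real" where
  "weight \<kappa> j = (\<Prod>i\<in>UNIV. pmf (bernoulli_pmf (prb \<kappa> i)) (j $ i))"

lemma sigma_cell_pos: "0 < \<sigma> (cell \<G> i)"
  using cell_mem(1)[OF groups] sigma_pos by simp

lemma prb_eq: "prb \<kappa> i = min (\<eta> * mag \<kappa> i * score \<kappa> i / \<sigma> (cell \<G> i)) 1"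
  by (simp add: prb_def mag_def score_def move_prob_def)

lemma mag_nonneg: "0 \<le> mag \<kappa> i"
  by (simp add: mag_def masked_magnitude_nonneg)

lemma score_nonneg: "0 \<le> score \<kappa> i"
  by (simp add: score_def power_score_nonneg)

lemma prb_nonneg: "0 \<le> prb \<kappa> i"
  using sigma_cell_pos[of i] eta_pos mag_nonneg[of \<kappa> i] score_nonneg[of \<kappa> i] by (simp add: prb_eq)

lemma prb_le_1: "prb \<kappa> i \<le> 1"
  by (simp add: prb_eq)

text \<open>Removes the code from the error terms: a score-weighted sum of group constants does not
  depend on \<open>\<kappa>\<close>.\<close>

lemma sum_score: "(\<Sum>i\<in>UNIV. c (cell \<G> i) * score \<kappa> i) = (\<Sum>G\<in>\<G>. real (card G) * c G)"
proof -
  have "(\<Sum>i\<in>UNIV. c (cell \<G> i) * score \<kappa> i)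
      = (\<Sum>G\<in>\<G>. \<Sum>i\<in>G. c G * power_score \<gamma> G (masked_magnitude klo khi \<kappa> (v \<kappa>)) i)"
    unfolding score_def by (rule sum.partition_on_cell[OF groups, symmetric]) simp
  also have "\<dots> = (\<Sum>G\<in>\<G>. real (card G) * c G)"
    by (simp add: sum_distrib_left[symmetric] sum_power_score mult.commute)
  finally show ?thesis .
qed

section \<open>Transition law of the chain and almost sure admissibility\<close>

lemma subalg: "subalgebra M (F t)"
  and k_measurable_F: "k t \<in> measurable (F t) (count_space UNIV)"
  and k_0: "\<omega> \<in> space M \<Longrightarrow> k 0 \<omega> = k0"
  using process by (simp_all add: qar_process_def)

lemma k_measurable: "k t \<in> measurable M (count_space UNIV)"
  using measurable_from_subalg[OF subalg k_measurable_F] .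

lemma J_measurable: "J t \<in> measurable M (count_space UNIV)"
  using process by (intro measurable_from_subalg[OF subalg[of "Suc t"]]) (simp add: qar_process_def)

lemma k_Suc: "\<omega> \<in> space M \<Longrightarrow> k (Suc t) \<omega> = move (k t \<omega>) (v (k t \<omega>)) (J t \<omega>)"
  using process route by (simp add: qar_process_def move_def vec_eq_iff)

lemma kJ_measurable: "(\<lambda>\<omega>. (k t \<omega>, J t \<omega>)) \<in> measurable M (count_space UNIV)"
proof -
  have "(\<lambda>\<omega>. (k t \<omega>, J t \<omega>)) \<in> measurable M (count_space UNIV \<Otimes>\<^sub>M count_space UNIV)"
    by (intro measurable_Pair k_measurable J_measurable)
  \<comment> \<open>Codes and bit vectors form countable types, so the product of their discrete
    sigma-algebras is again discrete.\<close>
  then show ?thesis by (simp add: pair_measure_countable)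
qed

text \<open>The event that the code is \<open>\<kappa>\<close> belongs to \<open>F t\<close>, so the
  conditional probability of the bit pattern may be integrated over it; there it is almost surely
  the constant \<open>weight \<kappa> j\<close>.\<close>

lemma prob_code_bits:
  "prob {\<omega>\<in>space M. (k t \<omega>, J t \<omega>) = (\<kappa>, j)} = prob {\<omega>\<in>space M. k t \<omega> = \<kappa>} * weight \<kappa> j"
proof -
  let ?A = "{\<omega>\<in>space M. k t \<omega> = \<kappa>}" and ?B = "{\<omega>\<in>space M. J t \<omega> = j}"
  interpret fs: finite_measure_subalgebra M "F t"
    by unfold_locales (rule subalg)
  have A: "?A \<in> sets (F t)"
    using level_set_measurable[OF k_measurable_F[of t], of \<kappa>] subalg[of t]
    by (simp add: subalgebra_def)
  have AM: "?A \<in> events" using A subalg[of t] by (auto simp: subalgebra_def)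
  have B: "?B \<in> events"
    by (rule level_set_measurable[OF J_measurable])
  have weights: "AE \<omega> in M. real_cond_exp M (F t) (indicator ?B) \<omega> =
      (\<Prod>G\<in>\<G>. \<Prod>i\<in>G. pmf (bernoulli_pmf
         (move_prob \<gamma> \<eta> \<sigma> G (masked_magnitude klo khi (k t \<omega>) (u t \<omega>)) i)) (j $ i))"
    using process by (simp add: qar_process_def)
  have "prob {\<omega>\<in>space M. (k t \<omega>, J t \<omega>) = (\<kappa>, j)} = prob (?A \<inter> ?B)"
    by (rule arg_cong[where f = prob]) auto
  also have "\<dots> = (\<integral>\<omega>. indicator (?A \<inter> ?B) \<omega> \<partial>M)"
    using AM B by (simp add: Int_absorb2)
  also have "\<dots> = (\<integral>\<omega>\<in>?A. indicator ?B \<omega> \<partial>M)"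
    by (simp add: set_lebesgue_integral_def indicator_inter_arith)
  also have "\<dots> = (\<integral>\<omega>\<in>?A. real_cond_exp M (F t) (indicator ?B) \<omega> \<partial>M)"
    using B A by (intro fs.real_cond_exp_intA) (auto simp: emeasure_eq_measure)
  also have "\<dots> = (\<integral>\<omega>. weight \<kappa> j * indicator ?A \<omega> \<partial>M)"
    unfolding set_lebesgue_integral_def
  proof (rule integral_cong_AE)
    show "(\<lambda>\<omega>. indicat_real ?A \<omega> *\<^sub>R real_cond_exp M (F t) (indicator ?B) \<omega>) \<in> borel_measurable M"
      using AM by measurable
    show "(\<lambda>\<omega>. weight \<kappa> j * indicator ?A \<omega>) \<in> borel_measurable M"
      using AM by measurable
    show "AE \<omega> in M. indicat_real ?A \<omega> *\<^sub>R real_cond_exp M (F t) (indicator ?B) \<omega>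
        = weight \<kappa> j * indicator ?A \<omega>"
      using weights
    proof (rule AE_mp, intro AE_I2 impI)
      fix \<omega> assume \<omega>: "\<omega> \<in> space M" and eq: "real_cond_exp M (F t) (indicator ?B) \<omega> =
        (\<Prod>G\<in>\<G>. \<Prod>i\<in>G. pmf (bernoulli_pmf
         (move_prob \<gamma> \<eta> \<sigma> G (masked_magnitude klo khi (k t \<omega>) (u t \<omega>)) i)) (j $ i))"
      have "real_cond_exp M (F t) (indicator ?B) \<omega> = weight (k t \<omega>) j"
        unfolding eq route[OF \<omega>] weight_def prb_def
        by (rule prod.partition_on_cell[OF groups]) simp
      then show "indicat_real ?A \<omega> *\<^sub>R real_cond_exp M (F t) (indicator ?B) \<omega>
          = weight \<kappa> j * indicator ?A \<omega>"
        by (simp add: indicator_def)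
    qed
  qed
  also have "\<dots> = prob ?A * weight \<kappa> j"
    using AM by (simp add: Int_absorb2)
  finally show ?thesis .
qed

text \<open>A pattern of nonzero weight sets a bit only where the probability is nonzero. There the
  masked magnitude is nonzero, so the mask certifies that the new coordinate stays in range.\<close>

lemma move_admissible:
  assumes "\<kappa> \<in> admissible_codes klo khi" "weight \<kappa> j \<noteq> 0"
  shows "move \<kappa> (v \<kappa>) j \<in> admissible_codes klo khi"
  unfolding admissible_codes_def
proof (intro CollectI allI)
  fix i
  have nz: "pmf (bernoulli_pmf (prb \<kappa> i)) (j $ i) \<noteq> 0"
    using assms(2) by (auto simp: weight_def)
  show "move \<kappa> (v \<kappa>) j $ i \<in> {klo $ i..khi $ i}"
  proof (cases "j $ i")
    case True
    with nz have "prb \<kappa> i \<noteq> 0" by (simp add: prb_nonneg prb_le_1)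
    then have "mag \<kappa> i \<noteq> 0" by (auto simp: prb_eq)
    then have "\<kappa> $ i - sign_int (v \<kappa> $ i) \<in> {klo $ i..khi $ i}"
      by (auto simp: mag_def masked_magnitude_def)
    with True show ?thesis by (simp add: move_def)
  next
    case False
    with assms(1) show ?thesis by (simp add: move_def admissible_codes_def)
  qed
qed

lemma AE_admissible: "AE \<omega> in M. k t \<omega> \<in> admissible_codes klo khi"
proof (induction t)
  case 0
  then show ?case using start by (auto simp: k_0)
next
  case (Suc t)
  \<comment> \<open>Each code-bit pair of zero weight is a null event, and there are only countably
    many pairs, so almost surely all of them are avoided at once.\<close>
  have "AE \<omega> in M. (k t \<omega>, J t \<omega>) \<noteq> (\<kappa>, j)" if "weight \<kappa> j = 0" for \<kappa> j
  proof (rule AE_I')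
    have "{\<omega>\<in>space M. (k t \<omega>, J t \<omega>) = (\<kappa>, j)} \<in> events"
      by (rule level_set_measurable[OF kJ_measurable])
    then show "{\<omega>\<in>space M. (k t \<omega>, J t \<omega>) = (\<kappa>, j)} \<in> null_sets M"
      using prob_code_bits[of t \<kappa> j] that by (simp add: null_sets_def emeasure_eq_measure)
  qed auto
  then have "AE \<omega> in M. \<forall>x. weight (fst x) (snd x) = 0 \<longrightarrow> (k t \<omega>, J t \<omega>) \<noteq> x"
    by (subst AE_all_countable) auto
  with Suc AE_space show ?case
    by eventually_elim (auto simp: k_Suc intro: move_admissible)
qed

section \<open>Telescoping a potential along the chain\<close>

text \<open>Integrating over the joint law of code and bits turns the drift bound at each code into
  a bound on expectations. \<open>K\<close> has to carry only the code at step \<open>t\<close>; the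
  successor may lie outside it.\<close>

lemma expected_potential_step:
  fixes \<phi> \<psi> :: "int^'n \<Rightarrow> real"
  assumes K: "finite K" and AE: "AE \<omega> in M. k t \<omega> \<in> K"
    and step: "\<And>\<kappa>. \<kappa> \<in> K \<Longrightarrow> (\<Sum>j\<in>UNIV. weight \<kappa> j * \<phi> (move \<kappa> (v \<kappa>) j)) \<le> \<phi> \<kappa> - \<psi> \<kappa> + C"
  shows "expectation (\<lambda>\<omega>. \<phi> (k (Suc t) \<omega>))
    \<le> expectation (\<lambda>\<omega>. \<phi> (k t \<omega>)) - expectation (\<lambda>\<omega>. \<psi> (k t \<omega>)) + C"
proof -
  let ?P = "\<lambda>\<kappa>. prob {\<omega>\<in>space M. k t \<omega> = \<kappa>}"
  have "expectation (\<lambda>\<omega>. \<phi> (k (Suc t) \<omega>))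
      = expectation (\<lambda>\<omega>. (\<lambda>(\<kappa>, j). \<phi> (move \<kappa> (v \<kappa>) j)) (k t \<omega>, J t \<omega>))"
    by (rule Bochner_Integration.integral_cong) (simp_all add: k_Suc)
  also have "\<dots> = (\<Sum>x\<in>K \<times> UNIV. (case x of (\<kappa>, j) \<Rightarrow> \<phi> (move \<kappa> (v \<kappa>) j))
      * prob {\<omega>\<in>space M. (k t \<omega>, J t \<omega>) = x})"
    by (rule expectation_finite_range(2)[OF kJ_measurable]) (use K AE in auto)
  also have "\<dots> = (\<Sum>\<kappa>\<in>K. \<Sum>j\<in>UNIV. \<phi> (move \<kappa> (v \<kappa>) j) * (?P \<kappa> * weight \<kappa> j))"
    unfolding sum.cartesian_product by (rule sum.cong) (auto simp del: prod.inject simp: prob_code_bits)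
  also have "\<dots> = (\<Sum>\<kappa>\<in>K. (\<Sum>j\<in>UNIV. weight \<kappa> j * \<phi> (move \<kappa> (v \<kappa>) j)) * ?P \<kappa>)"
    unfolding sum_distrib_right by (simp only: mult_ac)
  also have "\<dots> \<le> (\<Sum>\<kappa>\<in>K. (\<phi> \<kappa> - \<psi> \<kappa> + C) * ?P \<kappa>)"
    by (intro sum_mono mult_right_mono step) simp_all
  also have "\<dots> = expectation (\<lambda>\<omega>. \<phi> (k t \<omega>) - \<psi> (k t \<omega>) + C)"
    by (rule expectation_finite_range(2)[OF k_measurable K AE, symmetric])
  also have "\<dots> = expectation (\<lambda>\<omega>. \<phi> (k t \<omega>)) - expectation (\<lambda>\<omega>. \<psi> (k t \<omega>)) + C"
    by (simp add: expectation_finite_range(1)[OF k_measurable K AE] prob_space)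
  finally show ?thesis .
qed

lemma sum_expectation_le:
  fixes \<phi> \<psi> :: "int^'n \<Rightarrow> real"
  assumes K: "finite K" and AE: "\<And>t. t < T \<Longrightarrow> AE \<omega> in M. k t \<omega> \<in> K"
    and step: "\<And>\<kappa>. \<kappa> \<in> K \<Longrightarrow> (\<Sum>j\<in>UNIV. weight \<kappa> j * \<phi> (move \<kappa> (v \<kappa>) j)) \<le> \<phi> \<kappa> - \<psi> \<kappa> + C"
  shows "(\<Sum>t<T. expectation (\<lambda>\<omega>. \<psi> (k t \<omega>)))
    \<le> \<phi> k0 - Min (\<phi> ` admissible_codes klo khi) + real T * C"
proof -
  let ?E = "\<lambda>t. expectation (\<lambda>\<omega>. \<phi> (k t \<omega>))"
  have "(\<Sum>t<T. expectation (\<lambda>\<omega>. \<psi> (k t \<omega>))) \<le> (\<Sum>t<T. ?E t - ?E (Suc t) + C)"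
  proof (rule sum_mono)
    fix t assume "t \<in> {..<T}"
    then have "?E (Suc t) \<le> ?E t - expectation (\<lambda>\<omega>. \<psi> (k t \<omega>)) + C"
      by (intro expected_potential_step[OF K] AE step) auto
    then show "expectation (\<lambda>\<omega>. \<psi> (k t \<omega>)) \<le> ?E t - ?E (Suc t) + C" by linarith
  qed
  also have "\<dots> = ?E 0 - ?E T + real T * C"
    using sum_lessThan_telescope'[of ?E T] by (simp add: sum.distrib)
  also have "?E 0 = \<phi> k0"
  proof -
    have "?E 0 = expectation (\<lambda>\<omega>. \<phi> k0)"
      by (rule Bochner_Integration.integral_cong) (simp_all add: k_0)
    then show ?thesis by (simp add: prob_space)
  qed
  finally have "(\<Sum>t<T. expectation (\<lambda>\<omega>. \<psi> (k t \<omega>))) \<le> \<phi> k0 - ?E T + real T * C" .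
  \<comment> \<open>Membership in \<open>K\<close> is assumed only before step \<open>T\<close>, so
    the final potential is bounded below over all admissible codes instead.\<close>
  moreover have "Min (\<phi> ` admissible_codes klo khi) \<le> ?E T"
  proof -
    have "expectation (\<lambda>\<omega>. Min (\<phi> ` admissible_codes klo khi)) \<le> ?E T"
    proof (rule integral_mono_AE)
      show "integrable M (\<lambda>\<omega>. \<phi> (k T \<omega>))"
        by (rule expectation_finite_range(1)[OF k_measurable finite_admissible_codes AE_admissible])
      show "AE \<omega> in M. Min (\<phi> ` admissible_codes klo khi) \<le> \<phi> (k T \<omega>)"
        using AE_admissible[of T]
        by eventually_elim (simp add: finite_admissible_codes)
    qed simp
    then show ?thesis by (simp add: prob_space)
  qed
  ultimately show ?thesis by linarith
qed

section \<open>One-step descent at codes without clipping\<close>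

text \<open>Uses the actual magnitude in place of the route bound \<open>U\<close>, so that absence
  of clipping is a property of the code and the set can serve as \<open>K\<close> in the
  telescoping.\<close>

definition unclipped_codes :: "(int^'n) set" where
  "unclipped_codes =
    {\<kappa>\<in>admissible_codes klo khi. \<forall>i. \<eta> * mag \<kappa> i * score \<kappa> i \<le> \<sigma> (cell \<G> i)}"

lemma finite_unclipped_codes: "finite unclipped_codes"
  by (simp add: unclipped_codes_def finite_admissible_codes)

text \<open>Masked magnitudes are at most the sup norm of the route, hence at most \<open>U\<close>,
  and multiplying by a nonnegative score preserves this.\<close>

lemma AE_unclipped:
  assumes route_bound: "AE \<omega> in M. \<forall>t. infnorm (u t \<omega>) \<le> U"
    and no_clipping: "AE \<omega> in M. \<forall>t<T. \<forall>G\<in>\<G>. \<forall>i\<in>G.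
      \<eta> * U * power_score \<gamma> G (masked_magnitude klo khi (k t \<omega>) (u t \<omega>)) i \<le> \<sigma> G"
    and "t < T"
  shows "AE \<omega> in M. k t \<omega> \<in> unclipped_codes"
  using AE_space AE_admissible[of t] route_bound no_clipping
proof eventually_elim
  fix \<omega>
  assume \<omega>: "\<omega> \<in> space M" and adm: "k t \<omega> \<in> admissible_codes klo khi"
    and bound: "\<forall>t. infnorm (u t \<omega>) \<le> U"
    and clip: "\<forall>t<T. \<forall>G\<in>\<G>. \<forall>i\<in>G.
      \<eta> * U * power_score \<gamma> G (masked_magnitude klo khi (k t \<omega>) (u t \<omega>)) i \<le> \<sigma> G"
  have "\<eta> * mag (k t \<omega>) i * score (k t \<omega>) i \<le> \<sigma> (cell \<G> i)" for i
  proof -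
    have "mag (k t \<omega>) i \<le> U"
      using masked_magnitude_le[of klo khi "k t \<omega>" "u t \<omega>" i] bound
      by (metis mag_def route[OF \<omega>] order_trans)
    then have "\<eta> * mag (k t \<omega>) i * score (k t \<omega>) i \<le> \<eta> * U * score (k t \<omega>) i"
      using eta_pos score_nonneg by (intro mult_right_mono mult_left_mono) auto
    also have "\<dots> \<le> \<sigma> (cell \<G> i)"
      using clip \<open>t < T\<close> cell_mem[OF groups, of i] by (simp add: score_def route[OF \<omega>])
    finally show ?thesis .
  qed
  with adm show "k t \<omega> \<in> unclipped_codes" by (simp add: unclipped_codes_def)
qed

text \<open>One factor \<open>s $ i\<close> of the decrease cancels the denominator of the move
  probability, which leaves a linear term free of the scale and an error term with a single factor
  \<open>s $ i\<close>.\<close>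

lemma unclipped_descent:
  assumes smooth: "\<And>x y. f y \<le> f x + gradf x \<bullet> (y - x) + 1/2 * (\<Sum>i\<in>UNIV. L $ i * (y $ i - x $ i)\<^sup>2)"
    and scale: "\<And>i. s $ i = \<sigma> (cell \<G> i)"
    and \<kappa>: "\<kappa> \<in> unclipped_codes"
  shows "(\<Sum>j\<in>UNIV. weight \<kappa> j * f (code_point s (move \<kappa> (v \<kappa>) j)))
    \<le> f (code_point s \<kappa>) - (\<Sum>i\<in>UNIV. \<eta> * (score \<kappa> i *
        (mag \<kappa> i * (gradf (code_point s \<kappa>) $ i * sgn (v \<kappa> $ i)) - 1/2 * (L $ i * s $ i * mag \<kappa> i))))"
proof -
  have "prb \<kappa> i * (s $ i * (gradf (code_point s \<kappa>) $ i * sgn (v \<kappa> $ i)) - 1/2 * (L $ i * (s $ i * sgn (v \<kappa> $ i))\<^sup>2))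
    = \<eta> * (score \<kappa> i *
        (mag \<kappa> i * (gradf (code_point s \<kappa>) $ i * sgn (v \<kappa> $ i)) - 1/2 * (L $ i * s $ i * mag \<kappa> i)))" for i
  proof -
    have "\<eta> * mag \<kappa> i * score \<kappa> i / \<sigma> (cell \<G> i) \<le> 1"
      using \<kappa> sigma_cell_pos[of i] by (simp add: unclipped_codes_def)
    then have ps: "prb \<kappa> i * s $ i = \<eta> * mag \<kappa> i * score \<kappa> i"
      using sigma_cell_pos[of i] by (simp add: prb_eq scale min_def)
    \<comment> \<open>The squared sign is 1 unless the route vanishes, and then the magnitude
      vanishes too.\<close>
    have ms: "mag \<kappa> i * (sgn (v \<kappa> $ i))\<^sup>2 = mag \<kappa> i"
      by (cases "v \<kappa> $ i = 0") (simp_all add: mag_def masked_magnitude_def sgn_if)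
    have "prb \<kappa> i * (s $ i * (gradf (code_point s \<kappa>) $ i * sgn (v \<kappa> $ i)) - 1/2 * (L $ i * (s $ i * sgn (v \<kappa> $ i))\<^sup>2))
      = (prb \<kappa> i * s $ i) * (gradf (code_point s \<kappa>) $ i * sgn (v \<kappa> $ i) - 1/2 * (L $ i * s $ i * (sgn (v \<kappa> $ i))\<^sup>2))"
      by (simp add: algebra_simps power2_eq_square)
    also have "\<dots> = \<eta> * (score \<kappa> i * (mag \<kappa> i * (gradf (code_point s \<kappa>) $ i * sgn (v \<kappa> $ i))
        - 1/2 * (L $ i * s $ i * (mag \<kappa> i * (sgn (v \<kappa> $ i))\<^sup>2))))"
      unfolding ps by (simp add: algebra_simps)
    finally show ?thesis unfolding ms .
  qed
  then show ?thesis
    using expected_descent[OF smooth, of "prb \<kappa>" s \<kappa> "v \<kappa>"] prb_nonneg prb_le_1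
    by (simp only: weight_def)
qed

text \<open>Completing the square spends half of the gain on the curvature error.
  \<open>\<Lambda>\<close> is any groupwise bound on \<open>L\<close>; the theorem takes the group
  maximum.\<close>

lemma gradient_descent:
  assumes smooth: "\<And>x y. f y \<le> f x + gradf x \<bullet> (y - x) + 1/2 * (\<Sum>i\<in>UNIV. L $ i * (y $ i - x $ i)\<^sup>2)"
    and scale: "\<And>i. s $ i = \<sigma> (cell \<G> i)"
    and L: "\<And>i. 0 \<le> L $ i" "\<And>i. L $ i \<le> \<Lambda> (cell \<G> i)"
    and \<kappa>: "\<kappa> \<in> unclipped_codes" and v: "v \<kappa> = gradf (code_point s \<kappa>)"
  shows "(\<Sum>j\<in>UNIV. weight \<kappa> j * f (code_point s (move \<kappa> (v \<kappa>) j)))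
    \<le> f (code_point s \<kappa>) - \<eta> / 2 * (\<Sum>i\<in>UNIV. score \<kappa> i * (mag \<kappa> i)\<^sup>2)
      + \<eta> / 8 * (\<Sum>G\<in>\<G>. real (card G) * ((\<Lambda> G)\<^sup>2 * (\<sigma> G)\<^sup>2))"
proof -
  have "\<eta> / 2 * (score \<kappa> i * (mag \<kappa> i)\<^sup>2) - \<eta> / 8 * ((\<Lambda> (cell \<G> i))\<^sup>2 * (\<sigma> (cell \<G> i))\<^sup>2 * score \<kappa> i)
    \<le> \<eta> * (score \<kappa> i * (mag \<kappa> i * (gradf (code_point s \<kappa>) $ i * sgn (v \<kappa> $ i))
        - 1/2 * (L $ i * s $ i * mag \<kappa> i)))" for i
  proof -
    define a where "a = mag \<kappa> i"
    define l where "l = L $ i * s $ i"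
    \<comment> \<open>The route is the gradient itself, so gradient times sign is its absolute
      value; the mask is idempotent.\<close>
    have ag: "a * (gradf (code_point s \<kappa>) $ i * sgn (v \<kappa> $ i)) = a\<^sup>2"
      by (simp add: a_def mag_def masked_magnitude_def v power2_eq_square abs_sgn)
    have "l\<^sup>2 \<le> (\<Lambda> (cell \<G> i))\<^sup>2 * (\<sigma> (cell \<G> i))\<^sup>2"
      unfolding l_def power_mult_distrib[symmetric] scale using L[of i] sigma_cell_pos[of i]
      by (intro power_mono mult_right_mono mult_nonneg_nonneg) auto
    \<comment> \<open>Half of this square is
      \<open>l * a / 2 \<le> a\<^sup>2 / 2 + l\<^sup>2 / 8\<close>, the source of the constant
      1/8.\<close>
    moreover have "0 \<le> (a - l / 2)\<^sup>2" by simp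
    ultimately have "a\<^sup>2 / 2 - (\<Lambda> (cell \<G> i))\<^sup>2 * (\<sigma> (cell \<G> i))\<^sup>2 / 8 \<le> a\<^sup>2 - 1/2 * (l * a)"
      by (simp add: power2_eq_square algebra_simps)
    then have "\<eta> * (score \<kappa> i * (a\<^sup>2 / 2 - (\<Lambda> (cell \<G> i))\<^sup>2 * (\<sigma> (cell \<G> i))\<^sup>2 / 8))
        \<le> \<eta> * (score \<kappa> i * (a\<^sup>2 - 1/2 * (l * a)))"
      using eta_pos score_nonneg by (intro mult_left_mono) auto
    then show ?thesis unfolding a_def[symmetric] ag l_def[symmetric] by (simp add: algebra_simps)
  qed
  then have "(\<Sum>i\<in>UNIV. \<eta> / 2 * (score \<kappa> i * (mag \<kappa> i)\<^sup>2)
        - \<eta> / 8 * ((\<Lambda> (cell \<G> i))\<^sup>2 * (\<sigma> (cell \<G> i))\<^sup>2 * score \<kappa> i))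
    \<le> (\<Sum>i\<in>UNIV. \<eta> * (score \<kappa> i * (mag \<kappa> i * (gradf (code_point s \<kappa>) $ i * sgn (v \<kappa> $ i))
        - 1/2 * (L $ i * s $ i * mag \<kappa> i))))"
    by (rule sum_mono)
  then show ?thesis
    using unclipped_descent[OF smooth scale \<kappa>]
    unfolding sum_subtractf sum_distrib_left[symmetric] sum_score[of "\<lambda>G. (\<Lambda> G)\<^sup>2 * (\<sigma> G)\<^sup>2" \<kappa>]
    by linarith
qed

text \<open>The score is dropped from the gain, where it is at least 1 whenever the gain is nonzero,
  but kept in the error, where it sums to the group size.\<close>

lemma sign_descent:
  assumes smooth: "\<And>x y. f y \<le> f x + gradf x \<bullet> (y - x) + 1/2 * (\<Sum>i\<in>UNIV. L $ i * (y $ i - x $ i)\<^sup>2)"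
    and scale: "\<And>i. s $ i = \<sigma> (cell \<G> i)"
    and L: "\<And>i. 0 \<le> L $ i" "\<And>i. L $ i \<le> \<Lambda> (cell \<G> i)"
    and \<kappa>: "\<kappa> \<in> unclipped_codes" and v: "v \<kappa> = sign_vec (gradf (code_point s \<kappa>))"
  shows "(\<Sum>j\<in>UNIV. weight \<kappa> j * f (code_point s (move \<kappa> (v \<kappa>) j)))
    \<le> f (code_point s \<kappa>)
      - \<eta> * (\<Sum>i\<in>UNIV. \<bar>feasible_part klo khi \<kappa> (gradf (code_point s \<kappa>)) $ i\<bar>)
      + \<eta> / 2 * (\<Sum>G\<in>\<G>. real (card G) * (\<Lambda> G * \<sigma> G))"
proof -
  define g where "g = gradf (code_point s \<kappa>)"
  have mag_le: "mag \<kappa> i \<le> 1" for i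
    by (simp add: mag_def masked_magnitude_def v sign_vec_def sgn_if)
  have "\<eta> * \<bar>feasible_part klo khi \<kappa> g $ i\<bar> - \<eta> / 2 * (\<Lambda> (cell \<G> i) * \<sigma> (cell \<G> i) * score \<kappa> i)
    \<le> \<eta> * (score \<kappa> i * (mag \<kappa> i * (g $ i * sgn (v \<kappa> $ i)) - 1/2 * (L $ i * s $ i * mag \<kappa> i)))" for i
  proof -
    \<comment> \<open>A number and its sign have the same sign, so route and gradient have the same
      feasibility mask.\<close>
    have mg: "mag \<kappa> i * (g $ i * sgn (v \<kappa> $ i)) = \<bar>feasible_part klo khi \<kappa> g $ i\<bar>"
      by (simp add: mag_def masked_magnitude_def feasible_part_def v sign_vec_def g_def[symmetric]
          sign_int_def abs_mult sgn_if)
    have "\<bar>feasible_part klo khi \<kappa> g $ i\<bar> \<le> score \<kappa> i * \<bar>feasible_part klo khi \<kappa> g $ i\<bar>"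
    proof (cases "mag \<kappa> i = 0")
      case True
      with mg show ?thesis by simp
    next
      case False
      then have "mag \<kappa> i = 1"
        by (auto simp: mag_def masked_magnitude_def v sign_vec_def sgn_if split: if_splits)
      \<comment> \<open>Sign routes have magnitudes at most 1, so a magnitude equal to 1 is maximal
        in its group.\<close>
      then have "1 \<le> score \<kappa> i"
        unfolding score_def using cell_mem(2)[OF groups] mag_le
        by (intro power_score_ge_one) (auto simp: mag_def masked_magnitude_nonneg)
      then show ?thesis by (simp add: mult_le_cancel_right1)
    qed
    moreover have "score \<kappa> i * (L $ i * s $ i * mag \<kappa> i) \<le> score \<kappa> i * (\<Lambda> (cell \<G> i) * \<sigma> (cell \<G> i))"
    proof -
      have "L $ i * s $ i * mag \<kappa> i \<le> L $ i * s $ i * 1"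
        using L(1)[of i] sigma_cell_pos[of i] mag_le by (intro mult_left_mono) (auto simp: scale)
      also have "\<dots> \<le> \<Lambda> (cell \<G> i) * \<sigma> (cell \<G> i)"
        using L(2)[of i] sigma_cell_pos[of i] by (simp add: scale)
      finally show ?thesis by (intro mult_left_mono score_nonneg)
    qed
    ultimately have "\<bar>feasible_part klo khi \<kappa> g $ i\<bar> - 1/2 * (score \<kappa> i * (\<Lambda> (cell \<G> i) * \<sigma> (cell \<G> i)))
        \<le> score \<kappa> i * (mag \<kappa> i * (g $ i * sgn (v \<kappa> $ i)) - 1/2 * (L $ i * s $ i * mag \<kappa> i))"
      unfolding mg by (simp add: algebra_simps)
    from mult_left_mono[OF this, of \<eta>] eta_pos show ?thesis
      by (simp add: right_diff_distrib mult_ac)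
  qed
  then have "(\<Sum>i\<in>UNIV. \<eta> * \<bar>feasible_part klo khi \<kappa> g $ i\<bar>
        - \<eta> / 2 * (\<Lambda> (cell \<G> i) * \<sigma> (cell \<G> i) * score \<kappa> i))
    \<le> (\<Sum>i\<in>UNIV. \<eta> * (score \<kappa> i * (mag \<kappa> i * (g $ i * sgn (v \<kappa> $ i))
        - 1/2 * (L $ i * s $ i * mag \<kappa> i))))"
    by (rule sum_mono)
  then show ?thesis
    using unclipped_descent[OF smooth scale \<kappa>]
    unfolding sum_subtractf sum_distrib_left[symmetric] sum_score[of "\<lambda>G. \<Lambda> G * \<sigma> G" \<kappa>] g_def
    by linarith
qed

end

section \<open>The two convergence rates\<close>

theorem theorem4:
  fixes f :: "real^'n \<Rightarrow> real" and gradf :: "real^'n \<Rightarrow> real^'n" and L :: "real^'n"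
    and \<G> :: "'n set set" and s :: "real^'n" and \<sigma> :: "'n set \<Rightarrow> real"
    and klo khi k0 :: "int^'n" and \<gamma> \<eta> U :: real and T :: nat
    and M :: "'a measure" and F :: "nat \<Rightarrow> 'a measure"
    and u :: "nat \<Rightarrow> 'a \<Rightarrow> real^'n" and J :: "nat \<Rightarrow> 'a \<Rightarrow> bool^'n" and k :: "nat \<Rightarrow> 'a \<Rightarrow> int^'n"
  defines "q0 \<equiv> code_point s k0"
    and "q \<equiv> (\<lambda>t \<omega>. code_point s (k t \<omega>))"
    and "fmin \<equiv> Min (f ` codebook s klo khi)"
    and "LG \<equiv> (\<lambda>G. Max ((\<lambda>i. L $ i) ` G))"
    and "b \<equiv> (\<lambda>t \<omega> G i. power_score \<gamma> G (masked_magnitude klo khi (k t \<omega>) (u t \<omega>)) i)"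
    and "gQ \<equiv> (\<lambda>t \<omega>. feasible_part klo khi (k t \<omega>) (gradf (code_point s (k t \<omega>))))"
  assumes grad: "\<And>x. GDERIV f x :> gradf x"
    and L_nonneg: "\<And>i. 0 \<le> L $ i"
    and smooth: "\<And>x y. f y \<le> f x + gradf x \<bullet> (y - x) + 1/2 * (\<Sum>i\<in>UNIV. L $ i * (y $ i - x $ i)\<^sup>2)"
    and groups: "partition_on UNIV \<G>"
    and scale_pos: "\<And>i. 0 < s $ i"
    and scale_shared: "\<And>G i. G \<in> \<G> \<Longrightarrow> i \<in> G \<Longrightarrow> s $ i = \<sigma> G"
    and range_nonempty: "\<And>i. klo $ i \<le> khi $ i"
    and gamma: "0 \<le> \<gamma>" and eta: "0 < \<eta>" and T: "1 \<le> T"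
    and prob: "prob_space M"
    and start: "k0 \<in> admissible_codes klo khi"
    and process: "qar_process M F \<G> \<sigma> klo khi \<gamma> \<eta> k0 u J k"
    and route_bound: "AE \<omega> in M. \<forall>t. infnorm (u t \<omega>) \<le> U"
    and no_clipping: "AE \<omega> in M. \<forall>t<T. \<forall>G\<in>\<G>. \<forall>i\<in>G. \<eta> * U * b t \<omega> G i \<le> \<sigma> G"
  shows
    "((\<forall>t. \<forall>\<omega>\<in>space M. u t \<omega> = gradf (q t \<omega>)) \<longrightarrow>
        1 / real T * (\<Sum>t<T. \<integral>\<omega>. (norm (gQ t \<omega>))\<^sup>2 \<partial>M)
          \<le> 1 / real T * (\<Sum>t<T. \<integral>\<omega>. (\<Sum>G\<in>\<G>. \<Sum>i\<in>G. b t \<omega> G i * (gQ t \<omega> $ i)\<^sup>2) \<partial>M)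
        \<and>
        1 / real T * (\<Sum>t<T. \<integral>\<omega>. (\<Sum>G\<in>\<G>. \<Sum>i\<in>G. b t \<omega> G i * (gQ t \<omega> $ i)\<^sup>2) \<partial>M)
          \<le> 2 * (f q0 - fmin) / (\<eta> * real T)
             + 1/4 * (\<Sum>G\<in>\<G>. real (card G) * (LG G)\<^sup>2 * (\<sigma> G)\<^sup>2))
     \<and>
     ((\<forall>t. \<forall>\<omega>\<in>space M. u t \<omega> = sign_vec (gradf (q t \<omega>))) \<longrightarrow>
        1 / real T * (\<Sum>t<T. \<integral>\<omega>. (\<Sum>i\<in>UNIV. \<bar>gQ t \<omega> $ i\<bar>) \<partial>M)
          \<le> (f q0 - fmin) / (\<eta> * real T)
             + 1/2 * (\<Sum>G\<in>\<G>. real (card G) * LG G * \<sigma> G))"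
proof -
  interpret prob_space M by (rule prob)
  have sigma_pos: "0 < \<sigma> G" if "G \<in> \<G>" for G
  proof -
    have "G \<noteq> {}" using that groups by (auto simp: partition_on_def)
    then obtain i where "i \<in> G" by blast
    then show ?thesis using scale_pos[of i] scale_shared[OF that] by simp
  qed
  have scale: "s $ i = \<sigma> (cell \<G> i)" for i
    using scale_shared cell_mem[OF groups] by simp
  have LG: "L $ i \<le> LG (cell \<G> i)" for i
    using cell_mem(2)[OF groups] by (simp add: LG_def)
  have fmin: "fmin = Min ((\<lambda>\<kappa>. f (code_point s \<kappa>)) ` admissible_codes klo khi)"
    by (simp add: fmin_def codebook_def image_image)
  have proc: "code_driven_process M F \<G> \<sigma> klo khi k0 \<gamma> \<eta> u J k v"
    if "\<And>t \<omega>. \<omega> \<in> space M \<Longrightarrow> u t \<omega> = v (k t \<omega>)" for v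
    by unfold_locales (use process groups sigma_pos eta start that in auto)
  have GD: "1 / real T * (\<Sum>t<T. \<integral>\<omega>. (norm (gQ t \<omega>))\<^sup>2 \<partial>M)
          \<le> 1 / real T * (\<Sum>t<T. \<integral>\<omega>. (\<Sum>G\<in>\<G>. \<Sum>i\<in>G. b t \<omega> G i * (gQ t \<omega> $ i)\<^sup>2) \<partial>M)"
    "1 / real T * (\<Sum>t<T. \<integral>\<omega>. (\<Sum>G\<in>\<G>. \<Sum>i\<in>G. b t \<omega> G i * (gQ t \<omega> $ i)\<^sup>2) \<partial>M)
          \<le> 2 * (f q0 - fmin) / (\<eta> * real T)
             + 1/4 * (\<Sum>G\<in>\<G>. real (card G) * (LG G)\<^sup>2 * (\<sigma> G)\<^sup>2)"
    if u: "\<forall>t. \<forall>\<omega>\<in>space M. u t \<omega> = gradf (q t \<omega>)"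
  proof -
    define v where "v \<kappa> = gradf (code_point s \<kappa>)" for \<kappa>
    interpret P: code_driven_process M F \<G> \<sigma> klo khi k0 \<gamma> \<eta> u J k v
      by (rule proc) (use u in \<open>simp add: v_def q_def\<close>)
    \<comment> \<open>The two integrands, rewritten as functions of the code so that integrability
      follows from the finite range.\<close>
    define N where "N \<kappa> = (\<Sum>i\<in>UNIV. (P.mag \<kappa> i)\<^sup>2)" for \<kappa>
    define S where "S \<kappa> = (\<Sum>i\<in>UNIV. P.score \<kappa> i * (P.mag \<kappa> i)\<^sup>2)" for \<kappa>
    have gQ_sq: "(gQ t \<omega> $ i)\<^sup>2 = (P.mag (k t \<omega>) i)\<^sup>2" for t \<omega> i
      using abs_feasible_part[of klo khi "k t \<omega>" "v (k t \<omega>)" i]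
      by (metis gQ_def P.mag_def v_def power2_abs)
    have N: "(\<integral>\<omega>. (norm (gQ t \<omega>))\<^sup>2 \<partial>M) = (\<integral>\<omega>. N (k t \<omega>) \<partial>M)" for t
      by (simp only: N_def power2_norm_eq_inner inner_vec_def gQ_sq[symmetric])
         (simp add: power2_eq_square)
    have S: "(\<integral>\<omega>. (\<Sum>G\<in>\<G>. \<Sum>i\<in>G. b t \<omega> G i * (gQ t \<omega> $ i)\<^sup>2) \<partial>M) = (\<integral>\<omega>. S (k t \<omega>) \<partial>M)" for t
    proof (rule Bochner_Integration.integral_cong[OF refl])
      fix \<omega> assume \<omega>: "\<omega> \<in> space M"
      show "(\<Sum>G\<in>\<G>. \<Sum>i\<in>G. b t \<omega> G i * (gQ t \<omega> $ i)\<^sup>2) = S (k t \<omega>)"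
        unfolding S_def gQ_sq b_def P.score_def P.route[OF \<omega>]
        by (intro sum.partition_on_cell[OF groups]) simp
    qed
    have "N \<kappa> \<le> S \<kappa>" for \<kappa>
    proof -
      have "N \<kappa> = (\<Sum>G\<in>\<G>. \<Sum>i\<in>G. (masked_magnitude klo khi \<kappa> (v \<kappa>) $ i)\<^sup>2)"
        unfolding N_def P.mag_def by (rule sum.partition_on_cell[OF groups, symmetric]) simp
      also have "\<dots> \<le> (\<Sum>G\<in>\<G>. \<Sum>i\<in>G. power_score \<gamma> G (masked_magnitude klo khi \<kappa> (v \<kappa>)) i
          * (masked_magnitude klo khi \<kappa> (v \<kappa>) $ i)\<^sup>2)"
        by (intro sum_mono sum_power_score_square_ge) (simp_all add: masked_magnitude_nonneg)
      also have "\<dots> = S \<kappa>"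
        unfolding S_def P.mag_def P.score_def by (rule sum.partition_on_cell[OF groups]) simp
      finally show ?thesis .
    qed
    then have "(\<integral>\<omega>. N (k t \<omega>) \<partial>M) \<le> (\<integral>\<omega>. S (k t \<omega>) \<partial>M)" for t
      by (intro integral_mono
          expectation_finite_range(1)[OF P.k_measurable finite_admissible_codes P.AE_admissible])
    then show "1 / real T * (\<Sum>t<T. \<integral>\<omega>. (norm (gQ t \<omega>))\<^sup>2 \<partial>M)
          \<le> 1 / real T * (\<Sum>t<T. \<integral>\<omega>. (\<Sum>G\<in>\<G>. \<Sum>i\<in>G. b t \<omega> G i * (gQ t \<omega> $ i)\<^sup>2) \<partial>M)"
      unfolding N S by (intro mult_left_mono sum_mono) auto
    \<comment> \<open>The potential is \<open>f\<close> at the code point. Dividing by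
      \<open>\<eta> * T / 2\<close> turns the factors 1 and 1/8 into \<open>2 / (\<eta> * T)\<close>
      and 1/4.\<close>
    have "(\<Sum>t<T. expectation (\<lambda>\<omega>. \<eta> / 2 * S (k t \<omega>)))
      \<le> f (code_point s k0) - Min ((\<lambda>\<kappa>. f (code_point s \<kappa>)) ` admissible_codes klo khi)
        + real T * (\<eta> / 8 * (\<Sum>G\<in>\<G>. real (card G) * ((LG G)\<^sup>2 * (\<sigma> G)\<^sup>2)))"
      by (rule P.sum_expectation_le[OF P.finite_unclipped_codes
            P.AE_unclipped[OF route_bound no_clipping[unfolded b_def]]])
         (simp_all only: S_def P.gradient_descent[OF smooth scale L_nonneg LG _ v_def])
    then have "\<eta> / 2 * (\<Sum>t<T. \<integral>\<omega>. S (k t \<omega>) \<partial>M)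
      \<le> f q0 - fmin + real T * (\<eta> / 8 * (\<Sum>G\<in>\<G>. real (card G) * (LG G)\<^sup>2 * (\<sigma> G)\<^sup>2))"
      by (simp add: fmin q0_def sum_distrib_left mult.assoc)
    then show "1 / real T * (\<Sum>t<T. \<integral>\<omega>. (\<Sum>G\<in>\<G>. \<Sum>i\<in>G. b t \<omega> G i * (gQ t \<omega> $ i)\<^sup>2) \<partial>M)
          \<le> 2 * (f q0 - fmin) / (\<eta> * real T)
             + 1/4 * (\<Sum>G\<in>\<G>. real (card G) * (LG G)\<^sup>2 * (\<sigma> G)\<^sup>2)"
      unfolding S using eta T by (simp add: field_simps)
  qed
  have sign: "1 / real T * (\<Sum>t<T. \<integral>\<omega>. (\<Sum>i\<in>UNIV. \<bar>gQ t \<omega> $ i\<bar>) \<partial>M)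
          \<le> (f q0 - fmin) / (\<eta> * real T)
             + 1/2 * (\<Sum>G\<in>\<G>. real (card G) * LG G * \<sigma> G)"
    if u: "\<forall>t. \<forall>\<omega>\<in>space M. u t \<omega> = sign_vec (gradf (q t \<omega>))"
  proof -
    define v where "v \<kappa> = sign_vec (gradf (code_point s \<kappa>))" for \<kappa>
    interpret P: code_driven_process M F \<G> \<sigma> klo khi k0 \<gamma> \<eta> u J k v
      by (rule proc) (use u in \<open>simp add: v_def q_def\<close>)
    define S where "S \<kappa> = (\<Sum>i\<in>UNIV. \<bar>feasible_part klo khi \<kappa> (gradf (code_point s \<kappa>)) $ i\<bar>)" for \<kappa>
    \<comment> \<open>Here the gain carries the full factor \<open>\<eta>\<close>, so division by
      \<open>\<eta> * T\<close> gives the constants 1 and 1/2.\<close>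
    have "(\<Sum>t<T. expectation (\<lambda>\<omega>. \<eta> * S (k t \<omega>)))
      \<le> f (code_point s k0) - Min ((\<lambda>\<kappa>. f (code_point s \<kappa>)) ` admissible_codes klo khi)
        + real T * (\<eta> / 2 * (\<Sum>G\<in>\<G>. real (card G) * (LG G * \<sigma> G)))"
      by (rule P.sum_expectation_le[OF P.finite_unclipped_codes
            P.AE_unclipped[OF route_bound no_clipping[unfolded b_def]]])
         (simp_all only: S_def P.sign_descent[OF smooth scale L_nonneg LG _ v_def])
    then have "\<eta> * (\<Sum>t<T. \<integral>\<omega>. S (k t \<omega>) \<partial>M)
      \<le> f q0 - fmin + real T * (\<eta> / 2 * (\<Sum>G\<in>\<G>. real (card G) * LG G * \<sigma> G))"
      by (simp add: fmin q0_def sum_distrib_left mult.assoc)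
    then show ?thesis
      unfolding gQ_def S_def[symmetric] using eta T by (simp add: field_simps)
  qed
  from GD sign show ?thesis by blast
qed

end
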